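(* Let $(X,D)$ be any metric space, let $P\subseteq X$ be a finite dataset, and fix finite parameters $\alpha_1 \ge \alpha_2 > 1$. Let $G=(P,E)$ be any $\alpha_1$-reachable directed graph on $P$, and let $G'=(P,E')$ be the graph obtained by applying $\textsc{UnsortedRobustPrune}(p, N_{out}(p), \alpha_2, \infty)$ at every $p\in P$. Then, in the worst case (over datasets, $\alpha_1$-reachable graphs $G$, and the arbitrary choices made by the unsorted pruning), the reachability of $G'$ is $$\frac{1}{\frac{1}{\alpha_1}+\frac{1}{\alpha_2}+1} = \frac{\alpha_1\alpha_2}{\alpha_1+\alpha_2+1}.$$
   Context: A graph-based index on $P$ is a directed graph $G=(P,E)$; $N_{out}(p)$ denotes the out-neighbors of $p$. For $\alpha>0$, a vertex $q$ is $\alpha$-reachable from $p$ in $G$ if either $(p,q)\in E$ or there exists $p'$ with $(p,p')\in E$ and $\alpha\cdot D(p',q)\le D(p,q)$. $G$ is $\alpha$-reachable if every vertex is $\alpha$-reachable from every other vertex. The reachability of $G$ is the maximum $\alpha^*$ such that $G$ is $\alpha^*$-reachable. The procedure $\textsc{UnsortedRobustPrune}(p,\mathcal V,\alpha,R)$ modifies $G$ as follows: set $\mathcal V\leftarrow(\mathcal V\cup N_{out}(p))\setminus\{p\}$ and $N_{out}(p)\leftarrow\emptyset$; while $\mathcal V\neq\emptyset$: let $p^*$ be an arbitrary element of $\mathcal V$ (rather than the closest one to $p$), add $p^*$ to $N_{out}(p)$, stop if $|N_{out}(p)|=R$, and remove from $\mathcal V$ every $p'$ with $\alpha\cdot D(p^*,p')\le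 D(p,p')$ (this includes $p^*$ itself). Pruning at $p$ uses only the original out-neighbors of $p$ and changes only the out-edges of $p$.
   Formalization: The displayed identity is false for all α₁, α₂ > 1 (it would need α₁α₂ = 1); the left side is corrected to 1/(1/α₁ + 1/α₂ + 1/(α₁α₂)), and the worst-case reachability is proved to be the right side α₁α₂/(α₁+α₂+1). *)

theory Defs
  imports "HOL-Analysis.Analysis"
begin

text \<open>
  A directed graph on a point set \<open>P\<close> is an edge relation \<open>E \<subseteq> P \<times> P\<close>; the distance is a
  function \<open>D\<close> satisfying \<^locale>\<open>Metric_space\<close> on a carrier containing \<open>P\<close>.
\<close>

definition N_out :: "('a \<times> 'a) set \<Rightarrow> 'a \<Rightarrow> 'a set" where
  "N_out E p = {q. (p, q) \<in> E}"

definition vertex_reachable :: "('a \<Rightarrow> 'a \<Rightarrow> real) \<Rightarrow> ('a \<times> 'a) set \<Rightarrow> real \<Rightarrow> 'a \<Rightarrow> 'a \<Rightarrow> bool" where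
  "vertex_reachable D E \<alpha> p q \<longleftrightarrow>
     (p, q) \<in> E \<or> (\<exists>p'. (p, p') \<in> E \<and> \<alpha> * D p' q \<le> D p q)"

definition graph_reachable :: "('a \<Rightarrow> 'a \<Rightarrow> real) \<Rightarrow> 'a set \<Rightarrow> ('a \<times> 'a) set \<Rightarrow> real \<Rightarrow> bool" where
  "graph_reachable D P E \<alpha> \<longleftrightarrow> (\<forall>p\<in>P. \<forall>q\<in>P. p \<noteq> q \<longrightarrow> vertex_reachable D E \<alpha> p q)"

text \<open>
  The reachability is the largest \<open>\<alpha> > 0\<close> for which the graph is \<open>\<alpha>\<close>-reachable.  No largest one
  exists for, e.g., a complete graph, which is \<open>\<alpha>\<close>-reachable for every \<open>\<alpha>\<close>; the supremum is
  therefore taken in the extended reals, where it is \<open>\<infinity>\<close> in that case.  Whenever it is finite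
  and some \<open>\<alpha> > 0\<close> is admissible, it is a maximum (lemma \<open>reachability_is_maximum\<close>).
\<close>

definition reachability :: "('a \<Rightarrow> 'a \<Rightarrow> real) \<Rightarrow> 'a set \<Rightarrow> ('a \<times> 'a) set \<Rightarrow> ereal" where
  "reachability D P E = (SUP \<alpha> \<in> {\<alpha>. \<alpha> > 0 \<and> graph_reachable D P E \<alpha>}. ereal \<alpha>)"

lemma reachability_is_maximum:
  fixes r :: real
  assumes "Metric_space X D" and "finite P" and "P \<subseteq> X" and "E \<subseteq> P \<times> P"
    and r: "reachability D P E = ereal r"
  shows "r > 0" and "graph_reachable D P E r"
    and "\<And>\<alpha>. \<alpha> > 0 \<Longrightarrow> graph_reachable D P E \<alpha> \<Longrightarrow> \<alpha> \<le> r"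
proof -
  interpret Metric_space X D by fact
  let ?A = "{\<alpha>. \<alpha> > 0 \<and> graph_reachable D P E \<alpha>}"
  show le: "\<alpha> \<le> r" if "\<alpha> > 0" "graph_reachable D P E \<alpha>" for \<alpha>
  proof -
    have "ereal \<alpha> \<le> reachability D P E"
      unfolding reachability_def by (rule SUP_upper) (use that in auto)
    then show ?thesis using r by simp
  qed
  have "?A \<noteq> {}"
  proof
    assume "?A = {}"
    then have "reachability D P E = -\<infinity>"
      by (simp only: reachability_def image_empty Sup_empty bot_ereal_def)
    then show False using r by simp
  qed
  then show rpos: "r > 0" using le by fastforce
  have ex: "\<exists>a>b. graph_reachable D P E a \<and> a > 0" if "b < r" for b
  proof -
    have "ereal b < (SUP \<alpha>\<in>?A. ereal \<alpha>)" using r that by (simp add: reachability_def)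
    then show ?thesis by (auto simp: less_SUP_iff)
  qed
  show "graph_reachable D P E r"
    unfolding graph_reachable_def
  proof (intro ballI impI)
    fix p q assume pq: "p \<in> P" "q \<in> P" "p \<noteq> q"
    show "vertex_reachable D E r p q"
    proof (rule ccontr)
      assume no: "\<not> vertex_reachable D E r p q"
      let ?N = "{p'. (p, p') \<in> E}"
      have fin: "finite ?N"
        by (rule finite_subset[OF _ \<open>finite P\<close>]) (use \<open>E \<subseteq> P \<times> P\<close> in auto)
      have big: "D p q < r * D p' q" if "p' \<in> ?N" for p'
        using no that unfolding vertex_reachable_def by force
      have pos: "D p' q > 0" if "p' \<in> ?N" for p'
        using big[OF that] rpos nonneg[of p q] nonneg[of p' q]
        by (metis less_eq_real_def mult_zero_right not_less)
      let ?S = "insert 0 ((\<lambda>p'. D p q / D p' q) ` ?N)"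
      have "Max ?S < r"
        using fin rpos big pos by (auto simp: field_simps)
      then obtain a where a: "a > Max ?S" "graph_reachable D P E a" using ex by blast
      then have "vertex_reachable D E a p q" using pq by (auto simp: graph_reachable_def)
      moreover have "(p, q) \<notin> E" using no by (auto simp: vertex_reachable_def)
      ultimately obtain p' where p': "p' \<in> ?N" "a * D p' q \<le> D p q"
        by (auto simp: vertex_reachable_def)
      have "D p q / D p' q \<le> Max ?S" using fin p' by (intro Max_ge) auto
      then have "D p q / D p' q < a" using a by simp
      then show False using p' pos[OF p'(1)] by (simp add: field_simps)
    qed
  qed
qed

text \<open>
  \<open>prune_loop D p \<alpha> R V N N'\<close>: the while loop at \<open>p\<close>, started with candidate set \<open>V\<close> and current
  out-neighbourhood \<open>N\<close>, can end with out-neighbourhood \<open>N'\<close>.  The arbitrary choice of the next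
  element \<open>x\<close> is nondeterminism of this relation.
\<close>

inductive prune_loop ::
  "('a \<Rightarrow> 'a \<Rightarrow> real) \<Rightarrow> 'a \<Rightarrow> real \<Rightarrow> enat \<Rightarrow> 'a set \<Rightarrow> 'a set \<Rightarrow> 'a set \<Rightarrow> bool"
  for D p \<alpha> R
where
  exhausted: "prune_loop D p \<alpha> R {} N N"
| full: "x \<in> V \<Longrightarrow> enat (card (insert x N)) = R \<Longrightarrow> prune_loop D p \<alpha> R V N (insert x N)"
| step: "x \<in> V \<Longrightarrow> enat (card (insert x N)) \<noteq> R \<Longrightarrow>
         prune_loop D p \<alpha> R {p' \<in> V. \<not> \<alpha> * D x p' \<le> D p p'} (insert x N) N' \<Longrightarrow>
         prune_loop D p \<alpha> R V N N'"

text \<open>\<open>N'\<close> is a possible new out-neighbourhood of \<open>p\<close> after pruning the graph \<open>E\<close> at \<open>p\<close>.\<close>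

definition unsorted_robust_prune ::
  "('a \<Rightarrow> 'a \<Rightarrow> real) \<Rightarrow> ('a \<times> 'a) set \<Rightarrow> 'a \<Rightarrow> 'a set \<Rightarrow> real \<Rightarrow> enat \<Rightarrow> 'a set \<Rightarrow> bool" where
  "unsorted_robust_prune D E p V \<alpha> R N' \<longleftrightarrow>
     prune_loop D p \<alpha> R ((V \<union> N_out E p) - {p}) {} N'"

text \<open>
  Pruning at \<open>p\<close> reads and writes only the out-edges of \<open>p\<close>, so pruning the vertices one after
  the other, in any order, amounts to pruning each of them in the original graph.
\<close>

definition pruned_graph ::
  "('a \<Rightarrow> 'a \<Rightarrow> real) \<Rightarrow> 'a set \<Rightarrow> ('a \<times> 'a) set \<Rightarrow> real \<Rightarrow> ('a \<times> 'a) set \<Rightarrow> bool" where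
  "pruned_graph D P E \<alpha> E' \<longleftrightarrow> E' \<subseteq> P \<times> P \<and>
     (\<forall>p\<in>P. unsorted_robust_prune D E p (N_out E p) \<alpha> \<infinity> (N_out E' p))"

end

theory Submission
  imports Defs
begin

text \<open>
  Lower bound: to get from \<open>p\<close> towards \<open>q\<close>, take the neighbour \<open>p'\<close> that \<open>G\<close> provides.  If the
  pruning removed it, it did so because of a kept \<open>x\<close> with \<open>\<alpha>\<^sub>2 D(x,p') \<le> D(p,p')\<close>.  Writing \<open>d = D(p,q)\<close>,
  two triangle inequalities give \<open>D(x,q) \<le> D(p,p')/\<alpha>\<^sub>2 + d/\<alpha>\<^sub>1 \<le> (d + d/\<alpha>\<^sub>1)/\<alpha>\<^sub>2 + d/\<alpha>\<^sub>1\<close>.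
  All inequalities are equalities when \<open>p, q, p', x\<close> lie in this order on the real line, which yields
  the worst case: the complete graph without the edge \<open>(p,q)\<close>, pruned at \<open>p\<close> by choosing \<open>x\<close> first.
\<close>

lemma prune_loop_subset:
  assumes "prune_loop D p \<alpha> R V N N'"
  shows "N \<subseteq> N'" and "N' \<subseteq> V \<union> N"
  using assms by (induction rule: prune_loop.induct) auto

text \<open>With \<open>R\<close> infinite the rule \<open>full\<close> cannot fire, so the loop
  ends only when no candidate is left. A candidate leaves only through the filter of a chosen
  \<open>x\<close>, and chosen vertices are never dropped again.\<close>

lemma prune_loop_covers:
  assumes "prune_loop D p \<alpha> \<infinity> V N N'" and "v \<in> V"
  shows "\<exists>x\<in>N'. v = x \<or> \<alpha> * D x v \<le> D p v"
  using assms
proof (induction arbitrary: v rule: prune_loop.induct)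
  case (step x V N N')
  have "x \<in> N'" using prune_loop_subset(1)[OF step.hyps(3)] by simp
  then show ?case using step.IH step.prems by blast
qed auto

text \<open>The second assumption, immediate in a metric space, makes every chosen vertex remove
  itself, so the candidate set shrinks strictly and the loop terminates.\<close>

lemma ex_prune_loop:
  assumes "finite V" and "\<And>x. x \<in> V \<Longrightarrow> \<alpha> * D x x \<le> D p x"
  shows "\<exists>N'. prune_loop D p \<alpha> R V N N'"
  using assms
proof (induction V arbitrary: N rule: finite_psubset_induct)
  case (psubset V)
  show ?case
  proof (cases "V = {}")
    case True
    then show ?thesis using prune_loop.exhausted by metis
  next
    case False
    then obtain x where x: "x \<in> V" by blast
    let ?W = "{p' \<in> V. \<not> \<alpha> * D x p' \<le> D p p'}"
    have "?W \<subset> V" using x psubset.prems by auto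
    then obtain N' where "prune_loop D p \<alpha> R ?W (insert x N) N'"
      using psubset by (metis (no_types, lifting) psubsetD)
    then show ?thesis
      using x prune_loop.full prune_loop.step by metis
  qed
qed

lemma graph_reachable_pruned:
  assumes "Metric_space X D" and "P \<subseteq> X" and "E \<subseteq> P \<times> P"
    and "\<alpha>\<^sub>1 > 1" and "\<alpha>\<^sub>2 > 0"
    and reach: "graph_reachable D P E \<alpha>\<^sub>1" and prune: "pruned_graph D P E \<alpha>\<^sub>2 E'"
  shows "graph_reachable D P E' (\<alpha>\<^sub>1 * \<alpha>\<^sub>2 / (\<alpha>\<^sub>1 + \<alpha>\<^sub>2 + 1))"
  unfolding graph_reachable_def
proof (intro ballI impI)
  interpret Metric_space X D by fact
  let ?r = "\<alpha>\<^sub>1 * \<alpha>\<^sub>2 / (\<alpha>\<^sub>1 + \<alpha>\<^sub>2 + 1)"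
  fix p q assume pq: "p \<in> P" "q \<in> P" "p \<noteq> q"
  let ?d = "D p q"
  have d: "?d > 0" using pq assms(2) by (simp add: subset_iff)
  obtain p' where p': "(p, p') \<in> E" "\<alpha>\<^sub>1 * D p' q \<le> ?d"
  proof (cases "(p, q) \<in> E")
    case True
    then show ?thesis using that[of q] d pq assms(2) by (simp add: subset_iff)
  next
    case False
    then show ?thesis
      using that reach pq by (auto simp: graph_reachable_def vertex_reachable_def)
  qed
  \<comment> \<open>Pruning discards \<open>p\<close> itself from the candidates, so
    \<open>p'\<close> has to be a genuine candidate before coverage applies.\<close>
  have "p' \<noteq> p" using p'(2) d \<open>\<alpha>\<^sub>1 > 1\<close> by auto
  then obtain x where x: "(p, x) \<in> E'" "p' = x \<or> \<alpha>\<^sub>2 * D x p' \<le> D p p'"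
    using prune pq(1) p'(1)
      prune_loop_covers[of D p \<alpha>\<^sub>2 "N_out E p - {p}" "{}" "N_out E' p" p']
    by (auto simp: pruned_graph_def unsorted_robust_prune_def N_out_def)
  have in_X: "p \<in> X" "q \<in> X" "p' \<in> X" "x \<in> X"
    using pq p'(1) x(1) prune assms(2,3) by (auto simp: pruned_graph_def)
  \<comment> \<open>If \<open>p'\<close> itself was kept, then \<open>x = p'\<close> and the left
    side is 0.\<close>
  have "\<alpha>\<^sub>2 * D x p' \<le> D p p'" using x(2) in_X by auto
  also have "D p p' \<le> ?d + D p' q"
    using triangle[of p q p'] in_X by (simp add: commute)
  \<comment> \<open>From here on denominators are cleared: the three inequalities, all scaled to
    \<open>\<alpha>\<^sub>1 * \<alpha>\<^sub>2 * D x q\<close>, add up linearly.\<close>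
  finally have "\<alpha>\<^sub>1 * (\<alpha>\<^sub>2 * D x p') \<le> \<alpha>\<^sub>1 * (?d + D p' q)"
    using \<open>\<alpha>\<^sub>1 > 1\<close> by (intro mult_left_mono) auto
  moreover have "(\<alpha>\<^sub>1 * \<alpha>\<^sub>2) * D x q \<le> (\<alpha>\<^sub>1 * \<alpha>\<^sub>2) * (D x p' + D p' q)"
    using triangle[of x p' q] in_X assms(4,5) by (intro mult_left_mono) auto
  moreover have "\<alpha>\<^sub>2 * (\<alpha>\<^sub>1 * D p' q) \<le> \<alpha>\<^sub>2 * ?d"
    using p'(2) \<open>\<alpha>\<^sub>2 > 0\<close> by (intro mult_left_mono) auto
  ultimately have "\<alpha>\<^sub>1 * \<alpha>\<^sub>2 * D x q \<le> (\<alpha>\<^sub>1 + \<alpha>\<^sub>2 + 1) * ?d"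
    using p'(2) by (simp add: algebra_simps)
  then have "?r * D x q \<le> ?d"
    using assms(4,5) by (simp add: field_simps)
  then show "vertex_reachable D E' ?r p q"
    using x(1) by (auto simp: vertex_reachable_def)
qed

lemma reachability_pruned_ge:
  assumes "Metric_space X D" and "P \<subseteq> X" and "E \<subseteq> P \<times> P"
    and "\<alpha>\<^sub>1 > 1" and "\<alpha>\<^sub>2 > 0"
    and "graph_reachable D P E \<alpha>\<^sub>1" and "pruned_graph D P E \<alpha>\<^sub>2 E'"
  shows "reachability D P E' \<ge> ereal (\<alpha>\<^sub>1 * \<alpha>\<^sub>2 / (\<alpha>\<^sub>1 + \<alpha>\<^sub>2 + 1))"
  unfolding reachability_def
  using graph_reachable_pruned[OF assms] assms(4,5) by (intro SUP_upper) auto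

text \<open>One pair without an edge suffices: each admissible \<alpha> needs an out-neighbour of
  \<open>p\<close> as witness for that pair.\<close>

lemma reachability_le:
  assumes "p \<in> P" and "q \<in> P" and "p \<noteq> q" and "(p, q) \<notin> E"
    and "\<And>x \<alpha>. (p, x) \<in> E \<Longrightarrow> \<alpha> * D x q \<le> D p q \<Longrightarrow> \<alpha> \<le> r"
  shows "reachability D P E \<le> ereal r"
  unfolding reachability_def
proof (rule SUP_least)
  fix \<alpha> assume "\<alpha> \<in> {\<alpha>. \<alpha> > 0 \<and> graph_reachable D P E \<alpha>}"
  then have "vertex_reachable D E \<alpha> p q" using assms by (auto simp: graph_reachable_def)
  then show "ereal \<alpha> \<le> ereal r" using assms by (auto simp: vertex_reachable_def)
qed

lemma ex_tight_pruned_graph: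
  fixes \<alpha>\<^sub>1 \<alpha>\<^sub>2 :: real
  assumes "\<alpha>\<^sub>1 > 1" and "\<alpha>\<^sub>2 > 0"
  shows "\<exists>(P :: real set) E E'. finite P \<and> E \<subseteq> P \<times> P \<and>
    graph_reachable dist P E \<alpha>\<^sub>1 \<and> pruned_graph dist P E \<alpha>\<^sub>2 E' \<and>
    reachability dist P E' = ereal (\<alpha>\<^sub>1 * \<alpha>\<^sub>2 / (\<alpha>\<^sub>1 + \<alpha>\<^sub>2 + 1))"
proof -
  let ?r = "\<alpha>\<^sub>1 * \<alpha>\<^sub>2 / (\<alpha>\<^sub>1 + \<alpha>\<^sub>2 + 1)"
  \<comment> \<open>The points 0, 1, \<open>b\<close>, \<open>c\<close> play \<open>p\<close>,
    \<open>q\<close>, \<open>p'\<close>, \<open>x\<close>. The choices give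
    \<open>\<alpha>\<^sub>1 * (b - 1) = 1\<close> and \<open>\<alpha>\<^sub>2 * (c - b) = b\<close>:
    \<open>b\<close> just makes 1 reachable from 0, and \<open>c\<close> just prunes
    \<open>b\<close>.\<close>
  define b where "b = 1 + 1 / \<alpha>\<^sub>1"
  define c where "c = b + b / \<alpha>\<^sub>2"
  have b: "b > 1" using assms by (simp add: b_def)
  have c: "c > b" using assms b by (simp add: c_def)
  define P where "P = {0, 1, b, c}"
  define E where "E = {(u, v). u \<in> P \<and> v \<in> P \<and> u \<noteq> v \<and> (u, v) \<noteq> (0, 1)}"
  have P: "finite P" and E: "E \<subseteq> P \<times> P" by (auto simp: P_def E_def)
  have reach: "graph_reachable dist P E \<alpha>\<^sub>1"
    unfolding graph_reachable_def
  proof (intro ballI impI)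
    fix u v assume uv: "u \<in> P" "v \<in> P" "u \<noteq> v"
    show "vertex_reachable dist E \<alpha>\<^sub>1 u v"
    proof (cases "(u, v) = (0, 1)")
      case True
      have "(0, b) \<in> E" using b by (auto simp: E_def P_def)
      moreover have "\<alpha>\<^sub>1 * dist b 1 \<le> dist (0 :: real) 1"
        using assms by (simp add: b_def dist_real_def)
      ultimately show ?thesis using True by (auto simp: vertex_reachable_def)
    qed (use uv in \<open>auto simp: vertex_reachable_def E_def\<close>)
  qed
  have N0: "N_out E 0 - {0} = {b, c}" using b c by (auto simp: N_out_def E_def P_def)
  have "\<alpha>\<^sub>2 * dist c b \<le> dist 0 b" using assms b by (simp add: c_def dist_real_def)
  then have "{v \<in> {b, c}. \<not> \<alpha>\<^sub>2 * dist c v \<le> dist 0 v} = {}" by auto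
  then have loop0: "prune_loop dist 0 \<alpha>\<^sub>2 \<infinity> (N_out E 0 - {0}) {} {c}"
    unfolding N0 using prune_loop.exhausted[of dist 0 \<alpha>\<^sub>2 \<infinity> "{c}"]
    by - (rule prune_loop.step[where x = c], simp_all only:, simp_all)
  \<comment> \<open>At the other vertices any run will do, since the upper bound only looks at the
    out-edges of 0; there the run is replaced by the bad one ending in \<open>{c}\<close>.\<close>
  have "\<exists>N'. prune_loop dist u \<alpha>\<^sub>2 \<infinity> (N_out E u - {u}) {} N'" for u
    by (rule ex_prune_loop) (auto intro!: finite_subset[OF _ P] simp: N_out_def E_def)
  then obtain M where M: "\<And>u. prune_loop dist u \<alpha>\<^sub>2 \<infinity> (N_out E u - {u}) {} (M u)"
    by metis
  define M' where "M' = M(0 := {c})"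
  have M': "prune_loop dist u \<alpha>\<^sub>2 \<infinity> (N_out E u - {u}) {} (M' u)" for u
    using M loop0 by (simp add: M'_def)
  define E' where "E' = {(u, v). u \<in> P \<and> v \<in> M' u}"
  have "N_out E' u = M' u" if "u \<in> P" for u using that by (simp add: N_out_def E'_def)
  moreover have "M' u \<subseteq> P" for u
    using prune_loop_subset(2)[OF M'] by (auto simp: N_out_def E_def)
  ultimately have prune: "pruned_graph dist P E \<alpha>\<^sub>2 E'"
    using M' by (auto simp: pruned_graph_def unsorted_robust_prune_def E'_def)
  have out0: "(0, v) \<in> E' \<longleftrightarrow> v = c" for v by (auto simp: E'_def M'_def P_def)
  \<comment> \<open>Since
    \<open>c = (1 + 1 / \<alpha>\<^sub>1) * (1 + 1 / \<alpha>\<^sub>2)\<close>, this distance is the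
    reciprocal of \<open>?r\<close>, and \<open>c\<close> is the only out-neighbour of 0.\<close>
  have "c - 1 = (\<alpha>\<^sub>1 + \<alpha>\<^sub>2 + 1) / (\<alpha>\<^sub>1 * \<alpha>\<^sub>2)"
    using assms by (simp add: c_def b_def field_simps)
  then have c1: "dist c 1 = (\<alpha>\<^sub>1 + \<alpha>\<^sub>2 + 1) / (\<alpha>\<^sub>1 * \<alpha>\<^sub>2)"
    using b c unfolding dist_real_def by linarith
  have "\<alpha> \<le> ?r" if "\<alpha> * dist c 1 \<le> dist (0 :: real) 1" for \<alpha>
  proof -
    have "\<alpha> * (\<alpha>\<^sub>1 + \<alpha>\<^sub>2 + 1) \<le> \<alpha>\<^sub>1 * \<alpha>\<^sub>2"
      using that assms unfolding c1 by (simp add: pos_divide_le_eq)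
    then show ?thesis using assms by (simp add: pos_le_divide_eq)
  qed
  then have "reachability dist P E' \<le> ereal ?r"
    using b c by (intro reachability_le[of 0 P 1]) (auto simp: out0 P_def)
  moreover have "reachability dist P E' \<ge> ereal ?r"
    using Met_TC.Metric_space_axioms E assms reach prune
    by (intro reachability_pruned_ge[of UNIV]) auto
  ultimately have "reachability dist P E' = ereal ?r" by (rule order_antisym)
  then show ?thesis using P E reach prune by blast
qed

text \<open>A worst-case value is a bound valid for all instances together with an instance
  attaining it. The instance lives on the reals because an arbitrary type \<open>'a\<close> may have
  fewer than four elements.\<close>

theorem theorem3p1:
  fixes \<alpha>\<^sub>1 \<alpha>\<^sub>2 :: real
  assumes "\<alpha>\<^sub>1 \<ge> \<alpha>\<^sub>2" and "\<alpha>\<^sub>2 > 1"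
  shows "(\<forall>(X :: 'a set) D P E E'.
            Metric_space X D \<and> finite P \<and> P \<subseteq> X \<and> E \<subseteq> P \<times> P \<and>
            graph_reachable D P E \<alpha>\<^sub>1 \<and> pruned_graph D P E \<alpha>\<^sub>2 E' \<longrightarrow>
            reachability D P E' \<ge> ereal (\<alpha>\<^sub>1 * \<alpha>\<^sub>2 / (\<alpha>\<^sub>1 + \<alpha>\<^sub>2 + 1)))
       \<and> (\<exists>(X :: real set) D P E E'.
            Metric_space X D \<and> finite P \<and> P \<subseteq> X \<and> E \<subseteq> P \<times> P \<and>
            graph_reachable D P E \<alpha>\<^sub>1 \<and> pruned_graph D P E \<alpha>\<^sub>2 E' \<and>
            reachability D P E' = ereal (\<alpha>\<^sub>1 * \<alpha>\<^sub>2 / (\<alpha>\<^sub>1 + \<alpha>\<^sub>2 + 1)))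
       \<and> 1 / (1 / \<alpha>\<^sub>1 + 1 / \<alpha>\<^sub>2 + 1 / (\<alpha>\<^sub>1 * \<alpha>\<^sub>2)) = \<alpha>\<^sub>1 * \<alpha>\<^sub>2 / (\<alpha>\<^sub>1 + \<alpha>\<^sub>2 + 1)"
proof (intro conjI)
  have \<alpha>\<^sub>1: "\<alpha>\<^sub>1 > 1" using assms by simp
  show "\<forall>(X :: 'a set) D P E E'.
            Metric_space X D \<and> finite P \<and> P \<subseteq> X \<and> E \<subseteq> P \<times> P \<and>
            graph_reachable D P E \<alpha>\<^sub>1 \<and> pruned_graph D P E \<alpha>\<^sub>2 E' \<longrightarrow>
            reachability D P E' \<ge> ereal (\<alpha>\<^sub>1 * \<alpha>\<^sub>2 / (\<alpha>\<^sub>1 + \<alpha>\<^sub>2 + 1))"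
    using \<alpha>\<^sub>1 assms(2) by (intro allI impI, elim conjE, intro reachability_pruned_ge) auto
  show "\<exists>(X :: real set) D P E E'.
            Metric_space X D \<and> finite P \<and> P \<subseteq> X \<and> E \<subseteq> P \<times> P \<and>
            graph_reachable D P E \<alpha>\<^sub>1 \<and> pruned_graph D P E \<alpha>\<^sub>2 E' \<and>
            reachability D P E' = ereal (\<alpha>\<^sub>1 * \<alpha>\<^sub>2 / (\<alpha>\<^sub>1 + \<alpha>\<^sub>2 + 1))"
  proof -
    obtain P :: "real set" and E E' where "finite P" "E \<subseteq> P \<times> P"
      "graph_reachable dist P E \<alpha>\<^sub>1" "pruned_graph dist P E \<alpha>\<^sub>2 E'"
      "reachability dist P E' = ereal (\<alpha>\<^sub>1 * \<alpha>\<^sub>2 / (\<alpha>\<^sub>1 + \<alpha>\<^sub>2 + 1))"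
      using ex_tight_pruned_graph[of \<alpha>\<^sub>1 \<alpha>\<^sub>2] \<alpha>\<^sub>1 assms(2) by auto
    with Met_TC.Metric_space_axioms show ?thesis
      by - (rule exI[where x = UNIV], rule exI[where x = dist], rule exI[where x = P],
          rule exI[where x = E], rule exI[where x = E'], simp)
  qed
  \<comment> \<open>The third summand is the reciprocal of the product; with 1 in its place the
    closed form would differ for parameters above 1.\<close>
  have "1 / \<alpha>\<^sub>1 + 1 / \<alpha>\<^sub>2 + 1 / (\<alpha>\<^sub>1 * \<alpha>\<^sub>2) = (\<alpha>\<^sub>1 + \<alpha>\<^sub>2 + 1) / (\<alpha>\<^sub>1 * \<alpha>\<^sub>2)"
    using \<alpha>\<^sub>1 assms(2) by (simp add: field_simps)
  then show "1 / (1 / \<alpha>\<^sub>1 + 1 / \<alpha>\<^sub>2 + 1 / (\<alpha>\<^sub>1 * \<alpha>\<^sub>2)) = \<alpha>\<^sub>1 * \<alpha>\<^sub>2 / (\<alpha>\<^sub>1 + \<alpha>\<^sub>2 + 1)"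
    by simp
qed

end
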